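(* Let $M=\operatorname{Inv}\langle A\mid r_i=1\ (i\in I)\rangle$ be a finitely presented special inverse monoid. Then for all $i\in I$ the decomposition of $r_i$ into pieces computed by the Benois algorithm is a refinement of the decomposition of $r_i$ computed by the Adjan algorithm.
   Context: For an alphabet $A$, $\overline A=A\cup A^{-1}$ where $A^{-1}$ is a disjoint copy of formal inverses, $\overline A^*$ is the free monoid on $\overline A$, $w^{-1}$ is the formal inverse of a word $w$, $\operatorname{red}(w)$ is the free reduction of $w$, and the free group $F_A$ is identified with the set of reduced words under $u\cdot v=\operatorname{red}(uv)$. $\equiv$ denotes equality of words. $\operatorname{Inv}\langle A\mid R\rangle$ denotes the inverse monoid defined by the presentation. $\operatorname{pref}(w)$ is the set of prefixes of $w$. Here $A$ and $I$ are finite. Benois algorithm. Let $\Sigma=\bigcup_{i\in I}(\operatorname{pref}(r_i)\cup\operatorname{pref}(r_i^{-1}))\subseteq\overline A^*$ and $V=\operatorname{red}(\Sigma^* )\subseteq F_A$, where $\Sigma^*$ is the submonoid of $\overline A^*$ generated by $\Sigma$. The decomposition of $r_i$ computed by the Benois algorithm is the decomposition $r_i\equiv r_{i1}r_{i2}\cdots r_{ik_i}$ into non-empty words such that for every non-empty proper prefix $p$ of $r_i$: $\operatorname{red}(p^{-1})\in V$ if and only if $p\equiv r_{i1}\cdots r_{ij}$ for some $j\in\{1,\dots,k_i\}$. Adjan algorithm. A submonoid $T$ of $\overline A^*$ has property $(\mathcal A)$ if for all $\alpha,\beta,\gamma\in\overline A^*$, $\alpha\beta\in T$ and $\beta\gamma\in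 T$ imply $\{\alpha,\beta,\gamma\}\subseteq T$. Let $R=\{r_i: i\in I\}$ and let $U(R)$ be the smallest submonoid of $\overline A^*$ containing $R$ and having property $(\mathcal A)$. It is known that $U(R)$ is a free monoid freely generated by a finite biprefix code $B(R)$ (a set of non-empty words none of which is a proper prefix or a proper suffix of another). The decomposition of $r_i$ computed by the Adjan algorithm is the unique factorisation of $r_i\in U(R)$ as a product of words from $B(R)$. One decomposition of $r_i$ is a refinement of another if every prefix of $r_i$ that is a product of initial factors of the second is also a product of initial factors of the first. *)

theory Defs
  imports "HOL-Algebra.Group" "HOL-Library.Sublist"
begin

section \<open>Words over an alphabet with formal inverses\<close>

text \<open>A letter \<open>(a, True)\<close> stands for \<open>a\<close> and \<open>(a, False)\<close> for its formal inverse.\<close>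

type_synonym 'a letter = "'a \<times> bool"
type_synonym 'a word = "'a letter list"

definition words :: "'a set \<Rightarrow> 'a word set" where
  "words A = lists (A \<times> UNIV)"

fun linv :: "'a letter \<Rightarrow> 'a letter" where
  "linv (a, s) = (a, \<not> s)"

definition winv :: "'a word \<Rightarrow> 'a word" where
  "winv w = rev (map linv w)"

definition word_monoid :: "'a set \<Rightarrow> 'a word monoid" where
  "word_monoid A = \<lparr>carrier = words A, mult = (@), one = []\<rparr>"

lemma word_monoid_simps [simp]:
  "carrier (word_monoid A) = words A"
  "u \<otimes>\<^bsub>word_monoid A\<^esub> v = u @ v"
  "\<one>\<^bsub>word_monoid A\<^esub> = []"
  by (simp_all add: word_monoid_def)

lemma words_simps [simp]:
  "[] \<in> words A" "u @ v \<in> words A \<longleftrightarrow> u \<in> words A \<and> v \<in> words A"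
  by (auto simp: words_def)

lemma linv_linv [simp]: "linv (linv x) = x" by (cases x) auto

lemma winv_simps [simp]:
  "winv [] = []" "winv (u @ v) = winv v @ winv u" "winv (winv u) = u"
  by (simp_all add: winv_def rev_map o_def)

lemma winv_words [simp]: "winv u \<in> words A \<longleftrightarrow> u \<in> words A"
proof -
  have "linv x \<in> A \<times> UNIV \<longleftrightarrow> x \<in> A \<times> UNIV" for x by (cases x) auto
  then show ?thesis by (auto simp: words_def winv_def in_lists_conv_set)
qed

lemma monoid_word_monoid: "monoid (word_monoid A)"
  by (rule monoidI) auto

definition star :: "'a word set \<Rightarrow> 'a word set" where
  "star S = concat ` lists S"

lemma star_least:
  assumes "S \<subseteq> words A"
  shows "submonoid (star S) (word_monoid A)" "S \<subseteq> star S"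
    and "submonoid T (word_monoid A) \<Longrightarrow> S \<subseteq> T \<Longrightarrow> star S \<subseteq> T"
proof -
  have least: "concat ws \<in> T" if "submonoid T (word_monoid A)" "S \<subseteq> T" "ws \<in> lists S" for T ws
    using that(3)
  proof induction
    case Nil
    show ?case using submonoid.one_closed[OF that(1)] by simp
  next
    case (Cons u us)
    then show ?case using submonoid.m_closed[OF that(1), of u "concat us"] that(2) by auto
  qed
  have *: "concat ws \<in> words A" if "ws \<in> lists S" for ws
    using that assms by induction auto
  show "submonoid (star S) (word_monoid A)"
  proof
    show "star S \<subseteq> carrier (word_monoid A)" using * by (auto simp: star_def)
    show "\<one>\<^bsub>word_monoid A\<^esub> \<in> star S" by (auto simp: star_def intro: image_eqI[of _ _ "[]"])
    fix x y assume "x \<in> star S" "y \<in> star S"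
    then obtain us vs where "us \<in> lists S" "vs \<in> lists S" "x = concat us" "y = concat vs"
      by (auto simp: star_def)
    then show "x \<otimes>\<^bsub>word_monoid A\<^esub> y \<in> star S"
      by (auto simp: star_def intro!: image_eqI[of _ _ "us @ vs"])
  qed
  show "S \<subseteq> star S"
  proof
    fix x assume "x \<in> S"
    then show "x \<in> star S" by (auto simp: star_def intro!: image_eqI[of _ _ "[x]"])
  qed
  show "submonoid T (word_monoid A) \<Longrightarrow> S \<subseteq> T \<Longrightarrow> star S \<subseteq> T"
    using least by (auto simp: star_def)
qed

section \<open>Free reduction\<close>

inductive cancel :: "'a word \<Rightarrow> 'a word \<Rightarrow> bool" where
  "cancel (u @ [x, linv x] @ v) (u @ v)"

definition reduced :: "'a word \<Rightarrow> bool" where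
  "reduced w \<longleftrightarrow> (\<nexists>v. cancel w v)"

fun push :: "'a letter \<Rightarrow> 'a word \<Rightarrow> 'a word" where
  "push x [] = [x]"
| "push x (y # w) = (if y = linv x then w else x # y # w)"

text \<open>The lemmas \<open>cancels_red\<close>, \<open>reduced_red\<close> and \<open>red_unique\<close> below say that \<open>red w\<close> is
  the only reduced word obtainable from \<open>w\<close> by deleting factors \<open>x x\<inverse>\<close>.\<close>

definition red :: "'a word \<Rightarrow> 'a word" where
  "red w = foldr push w []"

lemma cancel_Cons: "cancel u v \<Longrightarrow> cancel (x # u) (x # v)"
proof (induction rule: cancel.induct)
  case (1 u y v)
  show ?case using cancel.intros[of "x # u" y v] by simp
qed

lemma cancels_Cons: "cancel\<^sup>*\<^sup>* u v \<Longrightarrow> cancel\<^sup>*\<^sup>* (x # u) (x # v)"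
  by (induction rule: rtranclp_induct) (auto intro: rtranclp.rtrancl_into_rtrancl cancel_Cons)

lemma reduced_simps [simp]:
  "reduced []" "reduced [x]"
  "reduced (x # y # w) \<longleftrightarrow> y \<noteq> linv x \<and> reduced (y # w)"
proof -
  show "reduced []" "reduced [x]" by (auto simp: reduced_def elim!: cancel.cases
     simp: append_eq_Cons_conv Cons_eq_append_conv)
  have "cancel (x # linv x # w) w" using cancel.intros[of "[]" x w] by simp
  moreover have "y = linv x \<or> (\<exists>v. cancel (y # w) v)" if "cancel (x # y # w) v" for v
    using that
  proof cases
    case (1 u z t)
    then show ?thesis by (cases u) (auto intro: cancel.intros[of "_" z t, simplified])
  qed
  ultimately show "reduced (x # y # w) \<longleftrightarrow> y \<noteq> linv x \<and> reduced (y # w)"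
    unfolding reduced_def by (metis cancel_Cons)
qed

lemma reduced_push: "reduced w \<Longrightarrow> reduced (push x w)"
  by (cases w rule: list.exhaust; cases "tl w") auto

lemma cancels_push: "cancel\<^sup>*\<^sup>* (x # w) (push x w)"
  using cancel.intros[of "[]" x "tl w"] by (cases w) auto

lemma push_push: "reduced w \<Longrightarrow> push x (push (linv x) w) = w"
  by (cases w; cases "tl w") auto

lemma reduced_red: "reduced (red w)"
  unfolding red_def by (induction w) (auto intro: reduced_push)

lemma cancels_red: "cancel\<^sup>*\<^sup>* w (red w)"
proof (induction w)
  case (Cons x w)
  then show ?case using rtranclp_trans[OF cancels_Cons[OF Cons, of x] cancels_push[of x "red w"]]
    by (simp add: red_def)
qed (simp add: red_def)

lemma red_reduced: "reduced w \<Longrightarrow> red w = w"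
proof (induction w)
  case (Cons x w)
  then show ?case by (cases w) (auto simp: red_def)
qed (simp add: red_def)

lemma red_cancel: "cancel u v \<Longrightarrow> red u = red v"
proof (induction rule: cancel.induct)
  case (1 u x v)
  show ?case using push_push[OF reduced_red[of v], of x] by (simp add: red_def)
qed

lemma red_unique:
  assumes "cancel\<^sup>*\<^sup>* w v" "reduced v"
  shows "v = red w"
proof -
  have "red w = red v" using assms(1) by (induction rule: rtranclp_induct) (auto dest: red_cancel)
  then show ?thesis using red_reduced[OF assms(2)] by simp
qed

section \<open>Special inverse monoid presentations\<close>

text \<open>The rules \<open>regular\<close> and \<open>commute\<close> generate the Vagner congruence on words, whose
  quotient is the free inverse monoid.\<close>

inductive inv_cong :: "'a set \<Rightarrow> 'a word set \<Rightarrow> 'a word \<Rightarrow> 'a word \<Rightarrow> bool"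
  for A :: "'a set" and R :: "'a word set" where
  refl: "u \<in> words A \<Longrightarrow> inv_cong A R u u"
| sym: "inv_cong A R u v \<Longrightarrow> inv_cong A R v u"
| trans: "inv_cong A R u v \<Longrightarrow> inv_cong A R v w \<Longrightarrow> inv_cong A R u w"
| mult: "inv_cong A R u v \<Longrightarrow> inv_cong A R x y \<Longrightarrow> inv_cong A R (u @ x) (v @ y)"
| relator: "w \<in> R \<Longrightarrow> w \<in> words A \<Longrightarrow> inv_cong A R w []"
| regular: "u \<in> words A \<Longrightarrow> inv_cong A R (u @ winv u @ u) u"
| commute: "u \<in> words A \<Longrightarrow> v \<in> words A \<Longrightarrow>
    inv_cong A R (u @ winv u @ v @ winv v) (v @ winv v @ u @ winv u)"

definition inv_class :: "'a set \<Rightarrow> 'a word set \<Rightarrow> 'a word \<Rightarrow> 'a word set" where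
  "inv_class A R u = {v. inv_cong A R u v}"

definition Inv_monoid :: "'a set \<Rightarrow> 'a word set \<Rightarrow> 'a word set monoid" where
  "Inv_monoid A R = \<lparr>carrier = inv_class A R ` words A,
     mult = (\<lambda>X Y. \<Union>u\<in>X. \<Union>v\<in>Y. inv_class A R (u @ v)),
     one = inv_class A R []\<rparr>"

lemma inv_cong_words: "inv_cong A R u v \<Longrightarrow> u \<in> words A \<and> v \<in> words A"
  by (induction rule: inv_cong.induct) auto

lemma inv_class_eq:
  "u \<in> words A \<Longrightarrow> inv_class A R u = inv_class A R v \<longleftrightarrow> inv_cong A R u v"
  unfolding inv_class_def set_eq_iff mem_Collect_eq
  by (meson inv_cong.refl inv_cong.sym inv_cong.trans)

lemma Inv_monoid_mult:
  assumes "u \<in> words A" "v \<in> words A"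
  shows "inv_class A R u \<otimes>\<^bsub>Inv_monoid A R\<^esub> inv_class A R v = inv_class A R (u @ v)"
  using assms inv_cong.refl[of u A R] inv_cong.refl[of v A R]
  unfolding Inv_monoid_def inv_class_def
  by (auto intro: inv_cong.trans inv_cong.mult)

lemma monoid_Inv_monoid: "monoid (Inv_monoid A R)"
proof -
  have [simp]: "carrier (Inv_monoid A R) = inv_class A R ` words A"
    "\<one>\<^bsub>Inv_monoid A R\<^esub> = inv_class A R []" by (simp_all add: Inv_monoid_def)
  show ?thesis by (rule monoidI) (auto simp: Inv_monoid_mult)
qed

text \<open>The presented monoid is indeed an inverse monoid.\<close>

lemma Inv_monoid_inverse:
  assumes X: "X \<in> carrier (Inv_monoid A R)"
  shows "\<exists>!Y. Y \<in> carrier (Inv_monoid A R) \<and>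
    X \<otimes>\<^bsub>Inv_monoid A R\<^esub> Y \<otimes>\<^bsub>Inv_monoid A R\<^esub> X = X \<and>
    Y \<otimes>\<^bsub>Inv_monoid A R\<^esub> X \<otimes>\<^bsub>Inv_monoid A R\<^esub> Y = Y"
proof -
  let ?M = "Inv_monoid A R"
  interpret monoid ?M by (rule monoid_Inv_monoid)
  have car: "carrier ?M = inv_class A R ` words A" by (simp add: Inv_monoid_def)
  have cls: "inv_class A R u = inv_class A R v" if "inv_cong A R u v" for u v
    using that inv_class_eq[of u A R v] inv_cong_words[OF that] by blast
  define f where "f X = inv_class A R (winv (SOME u. u \<in> words A \<and> X = inv_class A R u))" for X
  have rep: "\<exists>u\<in>words A. X = inv_class A R u \<and> f X = inv_class A R (winv u)"
    if "X \<in> carrier ?M" for X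
  proof -
    have "\<exists>u. u \<in> words A \<and> X = inv_class A R u" using that car by auto
    from someI_ex[OF this] show ?thesis unfolding f_def by blast
  qed
  have fc: "f X \<in> carrier ?M" if "X \<in> carrier ?M" for X using rep[OF that] car by auto
  have f1: "X \<otimes>\<^bsub>?M\<^esub> f X \<otimes>\<^bsub>?M\<^esub> X = X" if X: "X \<in> carrier ?M" for X
  proof -
    obtain u where u: "u \<in> words A" "X = inv_class A R u" "f X = inv_class A R (winv u)"
      using rep[OF X] by blast
    then show ?thesis using cls[OF inv_cong.regular[OF u(1)]] by (simp add: Inv_monoid_mult)
  qed
  have f2: "f X \<otimes>\<^bsub>?M\<^esub> X \<otimes>\<^bsub>?M\<^esub> f X = f X" if X: "X \<in> carrier ?M" for X
  proof -
    obtain u where u: "u \<in> words A" "X = inv_class A R u" "f X = inv_class A R (winv u)"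
      using rep[OF X] by blast
    then show ?thesis using cls[OF inv_cong.regular[of "winv u"]] by (simp add: Inv_monoid_mult)
  qed
  have comm: "X \<otimes>\<^bsub>?M\<^esub> f X \<otimes>\<^bsub>?M\<^esub> (Y \<otimes>\<^bsub>?M\<^esub> f Y) = Y \<otimes>\<^bsub>?M\<^esub> f Y \<otimes>\<^bsub>?M\<^esub> (X \<otimes>\<^bsub>?M\<^esub> f X)"
    if X: "X \<in> carrier ?M" and Y: "Y \<in> carrier ?M" for X Y
  proof -
    obtain u where u: "u \<in> words A" "X = inv_class A R u" "f X = inv_class A R (winv u)"
      using rep[OF X] by blast
    obtain v where v: "v \<in> words A" "Y = inv_class A R v" "f Y = inv_class A R (winv v)"
      using rep[OF Y] by blast
    show ?thesis using u v cls[OF inv_cong.commute[OF u(1) v(1)]] by (simp add: Inv_monoid_mult)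
  qed
  have comm': "X \<otimes>\<^bsub>?M\<^esub> f X \<otimes>\<^bsub>?M\<^esub> (f X \<otimes>\<^bsub>?M\<^esub> X) = f X \<otimes>\<^bsub>?M\<^esub> X \<otimes>\<^bsub>?M\<^esub> (X \<otimes>\<^bsub>?M\<^esub> f X)"
    if X: "X \<in> carrier ?M" for X
  proof -
    obtain u where u: "u \<in> words A" "X = inv_class A R u" "f X = inv_class A R (winv u)"
      using rep[OF X] by blast
    show ?thesis using u cls[OF inv_cong.commute[of u A "winv u"]] by (simp add: Inv_monoid_mult)
  qed
  have idem: "e \<otimes>\<^bsub>?M\<^esub> f e = e" if e: "e \<in> carrier ?M" "e \<otimes>\<^bsub>?M\<^esub> e = e" for e
  proof -
    define g where "g = f e"
    have g: "g \<in> carrier ?M" using fc e g_def by simp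
    have "g \<otimes>\<^bsub>?M\<^esub> e \<otimes>\<^bsub>?M\<^esub> (e \<otimes>\<^bsub>?M\<^esub> g) = g"
      using f2[OF e(1)] e g unfolding g_def by (metis m_assoc m_closed)
    then have *: "e \<otimes>\<^bsub>?M\<^esub> g \<otimes>\<^bsub>?M\<^esub> (g \<otimes>\<^bsub>?M\<^esub> e) = g"
      using comm'[OF e(1)] g_def by simp
    have "e \<otimes>\<^bsub>?M\<^esub> g = g" using * e g by (metis m_assoc m_closed)
    moreover have "g \<otimes>\<^bsub>?M\<^esub> e = g" using * e g by (metis m_assoc m_closed)
    ultimately have "e = g" using f1[OF e(1)] g_def by simp
    then show ?thesis using e g_def by simp
  qed
  have ic: "d \<otimes>\<^bsub>?M\<^esub> e = e \<otimes>\<^bsub>?M\<^esub> d"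
    if "d \<in> carrier ?M" "d \<otimes>\<^bsub>?M\<^esub> d = d" "e \<in> carrier ?M" "e \<otimes>\<^bsub>?M\<^esub> e = e" for d e
    using comm[of d e] idem that by simp
  have un: "Y = Z" if Y: "Y \<in> carrier ?M" "X \<otimes>\<^bsub>?M\<^esub> Y \<otimes>\<^bsub>?M\<^esub> X = X" "Y \<otimes>\<^bsub>?M\<^esub> X \<otimes>\<^bsub>?M\<^esub> Y = Y"
    and Z: "Z \<in> carrier ?M" "X \<otimes>\<^bsub>?M\<^esub> Z \<otimes>\<^bsub>?M\<^esub> X = X" "Z \<otimes>\<^bsub>?M\<^esub> X \<otimes>\<^bsub>?M\<^esub> Z = Z" for Y Z
  proof -
    have idr: "(X \<otimes>\<^bsub>?M\<^esub> W) \<otimes>\<^bsub>?M\<^esub> (X \<otimes>\<^bsub>?M\<^esub> W) = X \<otimes>\<^bsub>?M\<^esub> W"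
      "(W \<otimes>\<^bsub>?M\<^esub> X) \<otimes>\<^bsub>?M\<^esub> (W \<otimes>\<^bsub>?M\<^esub> X) = W \<otimes>\<^bsub>?M\<^esub> X"
      if "W \<in> carrier ?M" "X \<otimes>\<^bsub>?M\<^esub> W \<otimes>\<^bsub>?M\<^esub> X = X" for W
      using that X by (metis m_assoc m_closed)+
    have r: "(X \<otimes>\<^bsub>?M\<^esub> Z) \<otimes>\<^bsub>?M\<^esub> (X \<otimes>\<^bsub>?M\<^esub> Y) = (X \<otimes>\<^bsub>?M\<^esub> Y) \<otimes>\<^bsub>?M\<^esub> (X \<otimes>\<^bsub>?M\<^esub> Z)"
      using ic idr Y Z X by simp
    have l: "(Z \<otimes>\<^bsub>?M\<^esub> X) \<otimes>\<^bsub>?M\<^esub> (Y \<otimes>\<^bsub>?M\<^esub> X) = (Y \<otimes>\<^bsub>?M\<^esub> X) \<otimes>\<^bsub>?M\<^esub> (Z \<otimes>\<^bsub>?M\<^esub> X)"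
      using ic idr Y Z X by simp
    have "X \<otimes>\<^bsub>?M\<^esub> Y = X \<otimes>\<^bsub>?M\<^esub> Z" using r Y Z X by (metis m_assoc m_closed)
    moreover have "Y \<otimes>\<^bsub>?M\<^esub> X = Z \<otimes>\<^bsub>?M\<^esub> X" using l Y Z X by (metis m_assoc m_closed)
    ultimately show ?thesis using Y Z X by (metis m_assoc)
  qed
  show ?thesis
    using un fc[OF X] f1[OF X] f2[OF X] by (intro ex1I[of _ "f X"]) blast+
qed

section \<open>The Benois decomposition\<close>

definition benois_Sigma :: "'a word set \<Rightarrow> 'a word set" where
  "benois_Sigma R = (\<Union>w\<in>R. {p. prefix p w} \<union> {p. prefix p (winv w)})"

definition benois_V :: "'a word set \<Rightarrow> 'a word set" where
  "benois_V R = red ` star (benois_Sigma R)"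

definition is_benois_decomposition :: "'a word set \<Rightarrow> 'a word \<Rightarrow> 'a word list \<Rightarrow> bool" where
  "is_benois_decomposition R w ds \<longleftrightarrow> concat ds = w \<and> [] \<notin> set ds \<and>
     (\<forall>p. p \<noteq> [] \<and> strict_prefix p w \<longrightarrow>
        (red (winv p) \<in> benois_V R \<longleftrightarrow> (\<exists>j\<in>{1..length ds}. p = concat (take j ds))))"

definition benois_decomposition :: "'a word set \<Rightarrow> 'a word \<Rightarrow> 'a word list" where
  "benois_decomposition R w = (THE ds. is_benois_decomposition R w ds)"

lemma concat_take_prefix: "prefix (concat (take j ds)) (concat ds)"
  by (metis append_take_drop_id concat_append prefixI)

lemma decomposition_exists:
  "\<exists>ds. concat ds = w \<and> [] \<notin> set ds \<and>
     (\<forall>p. p \<noteq> [] \<and> strict_prefix p w \<longrightarrow>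
        (P p \<longleftrightarrow> (\<exists>j\<in>{1..length ds}. p = concat (take j ds))))"
proof (induction w rule: rev_induct)
  case Nil
  show ?case by (rule exI[of _ "[]"]) auto
next
  case (snoc x w)
  then obtain ds where ds: "concat ds = w" "[] \<notin> set ds"
    "\<And>p. p \<noteq> [] \<Longrightarrow> strict_prefix p w \<Longrightarrow>
        P p \<longleftrightarrow> (\<exists>j\<in>{1..length ds}. p = concat (take j ds))" by blast
  show ?case
  proof (cases "w = [] \<or> P w")
    case True
    have "P p \<longleftrightarrow> (\<exists>j\<in>{1..length (ds @ [[x]])}. p = concat (take j (ds @ [[x]])))"
      if p: "p \<noteq> []" "strict_prefix p (w @ [x])" for p
    proof -
      have pw: "prefix p w" using p by (metis prefix_order.less_le prefix_snoc)
      have eq: "(\<exists>j\<in>{1..length (ds @ [[x]])}. p = concat (take j (ds @ [[x]]))) \<longleftrightarrow>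
        (\<exists>j\<in>{1..length ds}. p = concat (take j ds))"
      proof
        assume "\<exists>j\<in>{1..length (ds @ [[x]])}. p = concat (take j (ds @ [[x]]))"
        then obtain j where j: "j \<in> {1..Suc (length ds)}" "p = concat (take j (ds @ [[x]]))" by auto
        have "j \<noteq> Suc (length ds)" using j(2) ds(1) p(2) by auto
        then show "\<exists>j\<in>{1..length ds}. p = concat (take j ds)" using j by (intro bexI[of _ j]) auto
      qed (force intro: bexI)
      show ?thesis
      proof (cases "p = w")
        case True': True
        then have "P p" using True p by auto
        moreover have "ds \<noteq> []" using p True' ds(1) by auto
        then have "\<exists>j\<in>{1..length ds}. p = concat (take j ds)"
          using True' ds(1) by (intro bexI[of _ "length ds"]) (auto simp: Suc_le_eq)
        ultimately show ?thesis using eq by blast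
      next
        case False
        then show ?thesis using eq ds(3) p pw by (metis prefix_order.less_le)
      qed
    qed
    then show ?thesis using ds by (intro exI[of _ "ds @ [[x]]"]) auto
  next
    case False
    then have "ds \<noteq> []" using ds(1) by auto
    then obtain es e where es: "ds = es @ [e]" by (metis rev_exhaust)
    have "P p \<longleftrightarrow> (\<exists>j\<in>{1..length (es @ [e @ [x]])}. p = concat (take j (es @ [e @ [x]])))"
      if p: "p \<noteq> []" "strict_prefix p (w @ [x])" for p
    proof -
      have pw: "prefix p w" using p by (metis prefix_order.less_le prefix_snoc)
      have "p \<noteq> w @ [x]" using p by auto
      have 1: "(\<exists>j\<in>{1..length (es @ [e @ [x]])}. p = concat (take j (es @ [e @ [x]]))) \<longleftrightarrow>
        (\<exists>j\<in>{1..length es}. p = concat (take j es))"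
      proof
        assume "\<exists>j\<in>{1..length (es @ [e @ [x]])}. p = concat (take j (es @ [e @ [x]]))"
        then obtain j where j: "j \<in> {1..Suc (length es)}" "p = concat (take j (es @ [e @ [x]]))" by auto
        have "j \<noteq> Suc (length es)" using j(2) ds(1) es \<open>p \<noteq> w @ [x]\<close> by auto
        then show "\<exists>j\<in>{1..length es}. p = concat (take j es)" using j by (intro bexI[of _ j]) auto
      qed (force intro: bexI)
      show ?thesis
      proof (cases "p = w")
        case True
        have "e \<noteq> []" using ds(2) es by auto
        have "p \<noteq> concat (take j es)" for j
        proof
          assume "p = concat (take j es)"
          then have "prefix w (concat es)" using True concat_take_prefix by metis
          then show False using ds(1) es \<open>e \<noteq> []\<close> by (auto dest: prefix_length_le)
        qed
        then show ?thesis using 1 True False by auto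
      next
        case False'': False
        have 2: "(\<exists>j\<in>{1..length ds}. p = concat (take j ds)) \<longleftrightarrow>
          (\<exists>j\<in>{1..length es}. p = concat (take j es))"
        proof
          assume "\<exists>j\<in>{1..length ds}. p = concat (take j ds)"
          then obtain j where j: "j \<in> {1..Suc (length es)}" "p = concat (take j ds)"
            using es by auto
          have "j \<noteq> Suc (length es)" using j(2) ds(1) es False'' by auto
          then show "\<exists>j\<in>{1..length es}. p = concat (take j es)"
            using j es by (intro bexI[of _ j]) auto
        qed (use es in \<open>force intro: bexI\<close>)
        show ?thesis using 1 2 ds(3)[of p] p pw False'' by (metis prefix_order.less_le)
      qed
    qed
    then show ?thesis using ds es by (intro exI[of _ "es @ [e @ [x]]"]) auto
  qed
qed

lemma decomposition_unique:
  assumes "concat ds = concat es" "[] \<notin> set ds" "[] \<notin> set es"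
    and "\<And>p. p \<noteq> [] \<Longrightarrow> strict_prefix p (concat ds) \<Longrightarrow>
      (\<exists>j\<in>{1..length ds}. p = concat (take j ds)) \<longleftrightarrow> (\<exists>j\<in>{1..length es}. p = concat (take j es))"
  shows "ds = es"
  using assms
proof (induction ds arbitrary: es)
  case Nil
  then show ?case by (cases es) auto
next
  case (Cons d ds)
  then obtain e es' where es: "es = e # es'" by (cases es) auto
  have first: "prefix c p" if "\<exists>j\<in>{1..n}. p = concat (take j (c # cs))" for c p :: "'a list" and cs n
  proof -
    from that obtain j where j: "j \<in> {1..n}" "p = concat (take j (c # cs))" by blast
    then show ?thesis by (cases j) auto
  qed
  have "d = e"
  proof (rule ccontr)
    assume ne: "d \<noteq> e"
    have pd: "prefix d (concat (d # ds))" by simp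
    have pe: "prefix e (concat (d # ds))" unfolding Cons.prems(1) es by simp
    have "prefix e d"
    proof (cases "d = concat (d # ds)")
      case False
      then have "strict_prefix d (concat (d # ds))" using pd by (simp add: strict_prefix_def)
      moreover have "\<exists>j\<in>{1..length (d # ds)}. d = concat (take j (d # ds))"
        by (intro bexI[of _ 1]) auto
      ultimately show ?thesis 
        using Cons.prems(2) Cons.prems(4)[of d] first[of _ d e es'] es by (metis list.set_intros(1))
    qed (use pe in metis)
    moreover have "prefix d e"
    proof (cases "e = concat (d # ds)")
      case False
      then have "strict_prefix e (concat (d # ds))" using pe by (simp add: strict_prefix_def)
      moreover have "\<exists>j\<in>{1..length es}. e = concat (take j es)"
        using es by (intro bexI[of _ 1]) auto
      ultimately show ?thesis 
        using Cons.prems(3) Cons.prems(4)[of e] first[of _ e d ds] es by (metis list.set_intros(1))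
    qed (use pd in metis)
    ultimately show False using ne by (simp add: prefix_order.antisym)
  qed
  have shift: "(\<exists>j\<in>{1..length cs}. p = concat (take j cs)) \<longleftrightarrow>
      (\<exists>j\<in>{1..length (d # cs)}. d @ p = concat (take j (d # cs)))"
    if "p \<noteq> []" for p cs
  proof
    assume "\<exists>j\<in>{1..length cs}. p = concat (take j cs)"
    then obtain j where "j \<in> {1..length cs}" "p = concat (take j cs)" by auto
    then show "\<exists>j\<in>{1..length (d # cs)}. d @ p = concat (take j (d # cs))"
      by (intro bexI[of _ "Suc j"]) auto
  next
    assume "\<exists>j\<in>{1..length (d # cs)}. d @ p = concat (take j (d # cs))"
    then obtain j where j: "j \<in> {1..length (d # cs)}" "d @ p = concat (take j (d # cs))" by auto
    then obtain k where k: "j = Suc k" by (cases j) auto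
    then show "\<exists>j\<in>{1..length cs}. p = concat (take j cs)"
      using j that by (intro bexI[of _ k]) (cases k; auto)+
  qed
  have "ds = es'"
  proof (rule Cons.IH)
    show "concat ds = concat es'" using Cons.prems(1) es \<open>d = e\<close> by simp
    show "[] \<notin> set ds" "[] \<notin> set es'" using Cons.prems es by auto
    fix p assume p: "p \<noteq> []" "strict_prefix p (concat ds)"
    then have "d @ p \<noteq> []" "strict_prefix (d @ p) (concat (d # ds))"
      by (auto simp: strict_prefix_def)
    from Cons.prems(4)[OF this] show "(\<exists>j\<in>{1..length ds}. p = concat (take j ds)) \<longleftrightarrow>
        (\<exists>j\<in>{1..length es'}. p = concat (take j es'))"
      using shift[OF p(1)] es \<open>d = e\<close> by blast
  qed
  then show ?case using es \<open>d = e\<close> by simp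
qed

lemma benois_decomposition_ex1: "\<exists>!ds. is_benois_decomposition R w ds"
proof (rule ex_ex1I)
  show "\<exists>ds. is_benois_decomposition R w ds"
    unfolding is_benois_decomposition_def by (rule decomposition_exists)
next
  fix ds es assume "is_benois_decomposition R w ds" "is_benois_decomposition R w es"
  then show "ds = es"
    unfolding is_benois_decomposition_def by (intro decomposition_unique) auto
qed

lemma is_benois_decomposition_benois_decomposition:
  "is_benois_decomposition R w (benois_decomposition R w)"
  unfolding benois_decomposition_def by (rule theI'[OF benois_decomposition_ex1])

section \<open>The Adjan decomposition\<close>

definition property_A :: "'a set \<Rightarrow> 'a word set \<Rightarrow> bool" where
  "property_A A T \<longleftrightarrow> (\<forall>\<alpha>\<in>words A. \<forall>\<beta>\<in>words A. \<forall>\<gamma>\<in>words A.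
     \<alpha> @ \<beta> \<in> T \<and> \<beta> @ \<gamma> \<in> T \<longrightarrow> {\<alpha>, \<beta>, \<gamma>} \<subseteq> T)"

definition adjan_U :: "'a set \<Rightarrow> 'a word set \<Rightarrow> 'a word set" where
  "adjan_U A R = \<Inter>{T. submonoid T (word_monoid A) \<and> R \<subseteq> T \<and> property_A A T}"

definition biprefix_code :: "'a word set \<Rightarrow> bool" where
  "biprefix_code B \<longleftrightarrow> [] \<notin> B \<and>
     (\<forall>u\<in>B. \<forall>v\<in>B. \<not> strict_prefix u v \<and> \<not> strict_suffix u v)"

definition freely_generates :: "'a word set \<Rightarrow> 'a word set \<Rightarrow> bool" where
  "freely_generates B T \<longleftrightarrow> star B = T \<and> (\<forall>w\<in>T. \<exists>!bs. bs \<in> lists B \<and> concat bs = w)"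

definition adjan_B :: "'a set \<Rightarrow> 'a word set \<Rightarrow> 'a word set" where
  "adjan_B A R = (THE B. freely_generates B (adjan_U A R))"

definition adjan_decomposition :: "'a set \<Rightarrow> 'a word set \<Rightarrow> 'a word \<Rightarrow> 'a word list" where
  "adjan_decomposition A R w = (THE bs. bs \<in> lists (adjan_B A R) \<and> concat bs = w)"

lemma adjan_U_least:
  assumes "R \<subseteq> words A"
  shows "submonoid (adjan_U A R) (word_monoid A)" "R \<subseteq> adjan_U A R" "property_A A (adjan_U A R)"
    and "submonoid T (word_monoid A) \<Longrightarrow> R \<subseteq> T \<Longrightarrow> property_A A T \<Longrightarrow> adjan_U A R \<subseteq> T"
proof -
  have "submonoid (words A) (word_monoid A)" by unfold_locales auto
  moreover have "property_A A (words A)" by (auto simp: property_A_def)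
  ultimately have sub: "adjan_U A R \<subseteq> words A" using assms by (auto simp: adjan_U_def)
  show "submonoid (adjan_U A R) (word_monoid A)"
  proof
    show "adjan_U A R \<subseteq> carrier (word_monoid A)" using sub by simp
    show "\<one>\<^bsub>word_monoid A\<^esub> \<in> adjan_U A R"
      using submonoid.one_closed by (fastforce simp: adjan_U_def)
    fix x y assume "x \<in> adjan_U A R" "y \<in> adjan_U A R"
    then show "x \<otimes>\<^bsub>word_monoid A\<^esub> y \<in> adjan_U A R"
      using submonoid.m_closed[of _ "word_monoid A" x y] by (auto simp: adjan_U_def)
  qed
  show "R \<subseteq> adjan_U A R" by (auto simp: adjan_U_def)
  show "property_A A (adjan_U A R)" unfolding property_A_def
  proof (intro ballI impI)
    fix \<alpha> \<beta> \<gamma> assume w: "\<alpha> \<in> words A" "\<beta> \<in> words A" "\<gamma> \<in> words A"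
      and *: "\<alpha> @ \<beta> \<in> adjan_U A R \<and> \<beta> @ \<gamma> \<in> adjan_U A R"
    have "{\<alpha>, \<beta>, \<gamma>} \<subseteq> T"
      if T: "submonoid T (word_monoid A)" "R \<subseteq> T" "property_A A T" for T
    proof -
      have "\<alpha> @ \<beta> \<in> T" "\<beta> @ \<gamma> \<in> T" using T * unfolding adjan_U_def by blast+
      then show ?thesis using T(3) w unfolding property_A_def by blast
    qed
    then show "{\<alpha>, \<beta>, \<gamma>} \<subseteq> adjan_U A R" unfolding adjan_U_def by blast
  qed
  show "submonoid T (word_monoid A) \<Longrightarrow> R \<subseteq> T \<Longrightarrow> property_A A T \<Longrightarrow> adjan_U A R \<subseteq> T"
    by (auto simp: adjan_U_def)
qed

definition irreducibles :: "'a word set \<Rightarrow> 'a word set" where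
  "irreducibles T = {b \<in> T. b \<noteq> [] \<and> (\<nexists>u v. u \<in> T \<and> v \<in> T \<and> u \<noteq> [] \<and> v \<noteq> [] \<and> b = u @ v)}"

lemma freely_generates_irreducibles:
  assumes "freely_generates B T"
  shows "B = irreducibles T"
proof -
  have un: "bs = cs" if "bs \<in> lists B" "cs \<in> lists B" "concat bs = concat cs" for bs cs
    using assms that unfolding freely_generates_def star_def by blast
  have T: "T = concat ` lists B" using assms unfolding freely_generates_def star_def by auto
  have BT: "b \<in> T" if "b \<in> B" for b using that T by (auto intro!: image_eqI[of _ _ "[b]"])
  have ne: "b \<noteq> []" if "b \<in> B" for b using un[of "[b]" "[]"] that by auto
  show ?thesis
  proof (intro equalityI subsetI)
    fix b assume b: "b \<in> B"
    have False if uv: "u \<in> T" "v \<in> T" "u \<noteq> []" "v \<noteq> []" "b = u @ v" for u v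
    proof -
      obtain us vs where "us \<in> lists B" "vs \<in> lists B" "u = concat us" "v = concat vs"
        using uv T by auto
      then have "us @ vs = [b]" using un[of "us @ vs" "[b]"] b uv by auto
      then show False using uv \<open>u = _\<close> \<open>v = _\<close> by (auto simp: append_eq_Cons_conv)
    qed
    then show "b \<in> irreducibles T" using b BT ne unfolding irreducibles_def by blast
  next
    fix b assume b: "b \<in> irreducibles T"
    then obtain bs where bs: "bs \<in> lists B" "b = concat bs" using T by (auto simp: irreducibles_def)
    then obtain c cs where c: "bs = c # cs" using b by (cases bs) (auto simp: irreducibles_def)
    have "c \<in> T" "concat cs \<in> T" "c \<noteq> []" "b = c @ concat cs" using bs c BT ne T by auto
    then have "concat cs = []" using b unfolding irreducibles_def by blast
    then show "b \<in> B" using bs(1) c \<open>b = c @ concat cs\<close>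
      by (metis append_Nil2 listsE)
  qed
qed

lemma property_A_code:
  assumes T: "submonoid T (word_monoid A)" "property_A A T"
  shows "biprefix_code (irreducibles T)" "freely_generates (irreducibles T) T"
proof -
  let ?B = "irreducibles T"
  have TA: "T \<subseteq> words A" using submonoid.subset[OF T(1)] by simp
  have one: "[] \<in> T" and mul: "\<And>u v. u \<in> T \<Longrightarrow> v \<in> T \<Longrightarrow> u @ v \<in> T"
    using submonoid.one_closed[OF T(1)] submonoid.m_closed[OF T(1)] by auto
  have left: "v \<in> T" if "u \<in> T" "u @ v \<in> T" for u v
    using T(2)[unfolded property_A_def, rule_format, of "[]" u v] that TA by auto
  have right: "u \<in> T" if "v \<in> T" "u @ v \<in> T" for u v
    using T(2)[unfolded property_A_def, rule_format, of u v "[]"] that TA by auto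
  have pre: "u = v" if uv: "u \<in> ?B" "v \<in> ?B" "prefix u v" for u v
  proof -
    obtain t where t: "v = u @ t" using uv(3) by (auto elim: prefixE)
    have "t \<in> T" using left[of u t] uv t by (auto simp: irreducibles_def)
    then show ?thesis using uv t unfolding irreducibles_def by blast
  qed
  have suf: "u = v" if uv: "u \<in> ?B" "v \<in> ?B" "suffix u v" for u v
  proof -
    obtain t where t: "v = t @ u" using uv(3) by (auto elim: suffixE)
    have "t \<in> T" using right[of u t] uv t by (auto simp: irreducibles_def)
    then show ?thesis using uv t unfolding irreducibles_def by blast
  qed
  show "biprefix_code ?B"
  proof -
    have "[] \<notin> ?B" by (simp add: irreducibles_def)
    then show ?thesis using pre suf
      unfolding biprefix_code_def strict_prefix_def strict_suffix_def by blast
  qed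
  have gen: "w \<in> concat ` lists ?B" if "w \<in> T" for w
    using that
  proof (induction "length w" arbitrary: w rule: less_induct)
    case less
    consider "w = []" | "w \<in> ?B"
      | u v where "u \<in> T" "v \<in> T" "u \<noteq> []" "v \<noteq> []" "w = u @ v"
      using less.prems unfolding irreducibles_def by blast
    then show ?case
    proof cases
      case 1
      then show ?thesis by (auto intro: image_eqI[of _ _ "[]"])
    next
      case 2
      then show ?thesis by (auto intro!: image_eqI[of _ _ "[w]"])
    next
      case (3 u v)
      obtain us where "us \<in> lists ?B" "u = concat us" using less.hyps[of u] 3 by auto
      moreover obtain vs where "vs \<in> lists ?B" "v = concat vs" using less.hyps[of v] 3 by auto
      ultimately show ?thesis using 3 by (intro image_eqI[of _ _ "us @ vs"]) auto
    qed
  qed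
  have "concat ws \<in> T" if "ws \<in> lists ?B" for ws
    using that by induction (use one mul in \<open>auto simp only: irreducibles_def concat.simps mem_Collect_eq\<close>)
  then have star: "star ?B = T" using gen by (auto simp: star_def)
  have un: "bs = cs" if "bs \<in> lists ?B" "cs \<in> lists ?B" "concat bs = concat cs" for bs cs
    using that
  proof (induction bs arbitrary: cs rule: list.induct)
    case Nil
    then show ?case by (cases cs) (auto simp: irreducibles_def)
  next
    case (Cons b bs)
    then obtain c cs' where c: "cs = c # cs'"
      by (cases cs) (auto simp: irreducibles_def)
    have eq: "b @ concat bs = c @ concat cs'" using Cons.prems(3) c by simp
    then have "prefix b (c @ concat cs')" "prefix c (c @ concat cs')"
      by (metis prefixI, simp)
    then have "prefix b c \<or> prefix c b" using prefix_same_cases by blast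
    moreover have "b \<in> ?B" "c \<in> ?B" using Cons.prems c by auto
    ultimately have "b = c" using pre by blast
    moreover have "bs = cs'" using Cons.prems c eq \<open>b = c\<close> by (intro Cons.IH) auto
    ultimately show ?case using c by simp
  qed
  show "freely_generates ?B T"
    unfolding freely_generates_def
  proof (intro conjI ballI ex_ex1I)
    show "star ?B = T" by (rule star)
    fix w assume "w \<in> T"
    then show "\<exists>bs. bs \<in> lists ?B \<and> concat bs = w" using gen by blast
  next
    fix w bs cs assume "bs \<in> lists ?B \<and> concat bs = w" "cs \<in> lists ?B \<and> concat cs = w"
    then show "bs = cs" using un by blast
  qed
qed

lemma adjan_B_eq:
  assumes "R \<subseteq> words A"
  shows "adjan_B A R = irreducibles (adjan_U A R)"
  unfolding adjan_B_def
  using property_A_code(2)[OF adjan_U_least(1,3)[OF assms]] freely_generates_irreducibles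
  by (rule the_equality)

lemma freely_generates_adjan_B:
  assumes "R \<subseteq> words A"
  shows "freely_generates (adjan_B A R) (adjan_U A R)" "biprefix_code (adjan_B A R)"
  using property_A_code[OF adjan_U_least(1,3)[OF assms]] adjan_B_eq[OF assms] by auto

lemma adjan_decomposition_ex1:
  assumes "R \<subseteq> words A" "w \<in> R"
  shows "\<exists>!bs. bs \<in> lists (adjan_B A R) \<and> concat bs = w"
  using freely_generates_adjan_B(1)[OF assms(1)] adjan_U_least(2)[OF assms(1)] assms(2)
  unfolding freely_generates_def by blast

lemma adjan_decomposition:
  assumes "R \<subseteq> words A" "w \<in> R"
  shows "adjan_decomposition A R w \<in> lists (adjan_B A R)" "concat (adjan_decomposition A R w) = w"
  using theI'[OF adjan_decomposition_ex1[OF assms]] unfolding adjan_decomposition_def by auto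

lemma finite_adjan_B:
  assumes R: "R \<subseteq> words A" and fin: "finite R"
  shows "finite (adjan_B A R)"
proof -
  let ?U = "adjan_U A R" and ?B = "adjan_B A R"
  define C where "C = (\<Union>w\<in>R. set (adjan_decomposition A R w))"
  have fg: "freely_generates ?B ?U" by (rule freely_generates_adjan_B[OF R])
  then have starU: "star ?B = ?U" and un: "\<And>bs cs. bs \<in> lists ?B \<Longrightarrow> cs \<in> lists ?B \<Longrightarrow>
      concat bs = concat cs \<Longrightarrow> bs = cs"
    unfolding freely_generates_def star_def by blast+
  have CB: "C \<subseteq> ?B" using adjan_decomposition(1)[OF R] by (fastforce simp: C_def)
  have UA: "?U \<subseteq> words A" using submonoid.subset[OF adjan_U_least(1)[OF R]] by simp
  have BU: "?B \<subseteq> ?U" by (simp add: adjan_B_eq[OF R] irreducibles_def)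
  have sub: "submonoid (star C) (word_monoid A)"
    using star_least(1)[of C A] CB BU UA by blast
  have "R \<subseteq> star C"
  proof
    fix w assume "w \<in> R"
    then show "w \<in> star C" using adjan_decomposition(2)[OF R, of w] unfolding star_def C_def
      by (intro image_eqI[of _ _ "adjan_decomposition A R w"]) auto
  qed
  have CU: "star C \<subseteq> ?U" using image_mono[OF lists_mono[OF CB], of concat] unfolding starU[symmetric] star_def .
  have split: "u \<in> star C \<and> v \<in> star C" if uv: "u @ v \<in> star C" "u \<in> ?U" "v \<in> ?U" for u v
  proof -
    have "u \<in> concat ` lists ?B" "v \<in> concat ` lists ?B" "u @ v \<in> concat ` lists C"
      using uv unfolding starU[symmetric] star_def by simp_all
    then obtain us vs ws where *: "us \<in> lists ?B" "vs \<in> lists ?B" "ws \<in> lists C"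
      "u = concat us" "v = concat vs" "u @ v = concat ws"
      by (elim imageE)
    then have "us @ vs = ws" using CB by (intro un) auto
    then show ?thesis using * unfolding star_def by auto
  qed
  have "property_A A (star C)"
    unfolding property_A_def
  proof (intro ballI impI)
    fix \<alpha> \<beta> \<gamma> assume w: "\<alpha> \<in> words A" "\<beta> \<in> words A" "\<gamma> \<in> words A"
      and *: "\<alpha> @ \<beta> \<in> star C \<and> \<beta> @ \<gamma> \<in> star C"
    then have "{\<alpha>, \<beta>, \<gamma>} \<subseteq> ?U"
      using CU adjan_U_least(3)[OF R] unfolding property_A_def by blast
    then show "{\<alpha>, \<beta>, \<gamma>} \<subseteq> star C" using * split[of \<alpha> \<beta>] split[of \<beta> \<gamma>] by blast
  qed
  then have UC: "?U \<subseteq> star C" using adjan_U_least(4)[OF R sub \<open>R \<subseteq> star C\<close>] by blast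
  have "?B \<subseteq> C"
  proof
    fix b assume b: "b \<in> ?B"
    then obtain ws where ws: "ws \<in> lists C" "concat ws = b" using UC BU by (auto simp: star_def)
    have "ws = [b]" using b CB ws by (intro un) auto
    then show "b \<in> C" using ws(1) by simp
  qed
  moreover have "finite C" using fin by (simp add: C_def)
  ultimately show ?thesis by (rule finite_subset)
qed

section \<open>Refinement\<close>

definition refines :: "'a word list \<Rightarrow> 'a word list \<Rightarrow> bool" where
  "refines ds es \<longleftrightarrow> concat ds = concat es \<and>
     (\<forall>p. (\<exists>k\<le>length es. p = concat (take k es)) \<longrightarrow> (\<exists>j\<le>length ds. p = concat (take j ds)))"

end

theory Submission
  imports Defs
begin

text \<open>
  Read words as elements of the free group, and call a word \<open>w\<close> hereditary when every prefix of
  \<open>w\<close> and every prefix of \<open>w\<inverse>\<close> represents an element of the Benois monoid \<open>V\<close>. The relators are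
  hereditary because \<open>V\<close> is generated by exactly these prefixes. The key point is that the
  hereditary words form a submonoid with property \<open>(\<A>)\<close> (\<open>property_A_hereditary\<close>): if
  \<open>\<alpha>\<beta>\<close> and \<open>\<beta>\<gamma>\<close> are hereditary then \<open>\<beta>\<close> is a prefix of \<open>\<beta>\<gamma>\<close> and \<open>\<beta>\<inverse>\<close> a prefix of \<open>(\<alpha>\<beta>)\<inverse>\<close>, so
  \<open>\<beta>\<close> is a unit of \<open>V\<close> and can be cancelled.

  By minimality, Adjan's monoid \<open>U(R)\<close> consists of hereditary words. A partial product \<open>p\<close> of
  the Adjan factors of a relator lies in \<open>U(R)\<close>, so \<open>p\<inverse>\<close> represents an element of \<open>V\<close>, which is the
  criterion for the Benois decomposition to cut after \<open>p\<close>.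
\<close>

section \<open>Free reduction of products\<close>

lemma red_append_cong:
  assumes "red u = red u'" and "red v = red v'"
  shows "red (u @ v) = red (u' @ v')"
proof -
  have left: "red (x @ y) = red (red x @ y)" for x y :: "'a word"
    using cancels_red[of x]
  proof (induction rule: rtranclp_induct)
    case (step s t)
    from step.hyps(2) have "cancel (s @ y) (t @ y)"
    proof cases
      case (1 p z q)
      then show ?thesis using cancel.intros[of p z "q @ y"] by simp
    qed
    then show ?case using step.IH red_cancel[of "s @ y" "t @ y"] by simp
  qed simp
  have right: "red (x @ v) = red (x @ v')" for x
    using assms(2) by (simp add: red_def)
  have "red (u @ v) = red (red u' @ v)" using left[of u v] assms(1) by simp
  also have "\<dots> = red (u' @ v')" using left[of u' v] right[of u'] by simp
  finally show ?thesis .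
qed

lemma red_append_winv_cancel: "red (u @ winv u @ v) = red v"
proof (induction u arbitrary: v rule: rev_induct)
  case (snoc x u)
  have "(u @ [x]) @ winv (u @ [x]) @ v = u @ [x, linv x] @ winv u @ v"
    by (simp add: winv_def)
  then show ?case using red_cancel[OF cancel.intros[of u x "winv u @ v"]] snoc by simp
qed simp

section \<open>The monoid generated by prefixes of relators\<close>

lemma benois_V_append:
  assumes "red u \<in> benois_V R" and "red v \<in> benois_V R"
  shows "red (u @ v) \<in> benois_V R"
proof -
  obtain x y where x: "x \<in> star (benois_Sigma R)" "red u = red x"
    and y: "y \<in> star (benois_Sigma R)" "red v = red y"
    using assms by (auto simp: benois_V_def)
  have "submonoid (star (benois_Sigma R)) (word_monoid UNIV)"
    by (rule star_least(1)) (auto simp: words_def)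
  then have "x @ y \<in> star (benois_Sigma R)"
    using submonoid.m_closed[of _ "word_monoid UNIV" x y] x(1) y(1) by simp
  then show ?thesis
    using red_append_cong[OF x(2) y(2)] by (auto simp: benois_V_def)
qed

lemma benois_V_cancel_left:
  assumes "red (winv u) \<in> benois_V R" and "red (u @ v) \<in> benois_V R"
  shows "red v \<in> benois_V R"
  using benois_V_append[OF assms] red_append_winv_cancel[of "winv u" v] by simp

lemma benois_Sigma_V: "p \<in> benois_Sigma R \<Longrightarrow> red p \<in> benois_V R"
  using star_least(2)[of "benois_Sigma R" UNIV] by (auto simp: benois_V_def words_def)

section \<open>Hereditary words and property (A)\<close>

text \<open>The Benois criterion asks only about \<open>p\<inverse>\<close>, but the set of all words that represent units of
  \<open>V\<close> need not have property \<open>(\<A>)\<close>: it contains \<open>a a\<inverse>\<close> and \<open>a\<inverse> a\<close> for every letter \<open>a\<close>, although \<open>a\<close>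
  need not represent an element of \<open>V\<close>. Requiring all prefixes to represent elements of \<open>V\<close> makes
  the overlap \<open>\<beta>\<close> of two such words a unit.\<close>

definition hereditary :: "'a set \<Rightarrow> 'a word set \<Rightarrow> 'a word set" where
  "hereditary A R = {w \<in> words A. \<forall>p. prefix p w \<or> prefix p (winv w) \<longrightarrow> red p \<in> benois_V R}"

lemma submonoid_hereditary:
  "submonoid (hereditary A R) (word_monoid A)"
proof
  show "hereditary A R \<subseteq> carrier (word_monoid A)" by (auto simp: hereditary_def)
  have "[] \<in> star (benois_Sigma R)" by (auto simp: star_def intro: image_eqI[of _ _ "[]"])
  then show "\<one>\<^bsub>word_monoid A\<^esub> \<in> hereditary A R"
    by (auto simp: hereditary_def benois_V_def)
  fix x y assume "x \<in> hereditary A R" "y \<in> hereditary A R"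
  then show "x \<otimes>\<^bsub>word_monoid A\<^esub> y \<in> hereditary A R"
    by (auto simp: hereditary_def prefix_append intro: benois_V_append)
qed

lemma relators_hereditary: "R \<subseteq> words A \<Longrightarrow> R \<subseteq> hereditary A R"
  by (auto simp: hereditary_def benois_Sigma_def intro!: benois_Sigma_V)

text \<open>A prefix of \<open>\<gamma>\<close> is a prefix of \<open>\<beta>\<gamma>\<close> cancelled by \<open>\<beta>\<close>, and dually a prefix of \<open>\<alpha>\<inverse>\<close> is a prefix of
  \<open>\<beta>\<inverse>\<alpha>\<inverse>\<close> cancelled by \<open>\<beta>\<inverse>\<close>; every other prefix in question is a prefix of one of the given
  words or their inverses.\<close>

lemma property_A_hereditary: "property_A A (hereditary A R)"
  unfolding property_A_def
proof (intro ballI impI)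
  fix \<alpha> \<beta> \<gamma>
  assume w: "\<alpha> \<in> words A" "\<beta> \<in> words A" "\<gamma> \<in> words A"
    and "\<alpha> @ \<beta> \<in> hereditary A R \<and> \<beta> @ \<gamma> \<in> hereditary A R"
  then have ab: "prefix p (\<alpha> @ \<beta>) \<or> prefix p (winv \<beta> @ winv \<alpha>) \<Longrightarrow> red p \<in> benois_V R"
    and bc: "prefix p (\<beta> @ \<gamma>) \<or> prefix p (winv \<gamma> @ winv \<beta>) \<Longrightarrow> red p \<in> benois_V R" for p
    by (auto simp: hereditary_def)
  have b: "red \<beta> \<in> benois_V R" "red (winv \<beta>) \<in> benois_V R" using ab bc by auto
  have "red p \<in> benois_V R" if "prefix p \<gamma>" for p
    using benois_V_cancel_left[OF b(2), of p] bc[of "\<beta> @ p"] that by simp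
  moreover have "red p \<in> benois_V R" if "prefix p (winv \<alpha>)" for p
    using benois_V_cancel_left[of "winv \<beta>" R p] b(1) ab[of "winv \<beta> @ p"] that by simp
  ultimately show "{\<alpha>, \<beta>, \<gamma>} \<subseteq> hereditary A R"
    using w ab bc by (auto simp: hereditary_def prefix_append)
qed

lemma adjan_U_inverse_in_benois_V:
  assumes "R \<subseteq> words A" and "p \<in> adjan_U A R"
  shows "red (winv p) \<in> benois_V R"
  using adjan_U_least(4)[OF assms(1) submonoid_hereditary
      relators_hereditary[OF assms(1)] property_A_hereditary] assms(2)
  by (auto simp: hereditary_def)

section \<open>Refinement\<close>

lemma adjan_partial_product_in_U:
  assumes "R \<subseteq> words A" and "w \<in> R"
  shows "concat (take k (adjan_decomposition A R w)) \<in> adjan_U A R"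
proof -
  have "take k (adjan_decomposition A R w) \<in> lists (adjan_B A R)"
    using adjan_decomposition(1)[OF assms] by (auto dest: in_set_takeD)
  then show ?thesis
    using freely_generates_adjan_B(1)[OF assms(1)] by (auto simp: freely_generates_def star_def)
qed

theorem theorem4p5:
  fixes A :: "'a set" and I :: "'i set" and r :: "'i \<Rightarrow> 'a word" and M :: "'a word set monoid"
  assumes "finite A" and "finite I" and "\<And>i. i \<in> I \<Longrightarrow> r i \<in> words A"
    and "M = Inv_monoid A (r ` I)"
  shows "\<forall>i\<in>I. refines (benois_decomposition (r ` I) (r i)) (adjan_decomposition A (r ` I) (r i))"
proof
  fix i assume i: "i \<in> I"
  let ?R = "r ` I"
  let ?ds = "benois_decomposition ?R (r i)" and ?es = "adjan_decomposition A ?R (r i)"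
  have R: "?R \<subseteq> words A" "r i \<in> ?R" using assms(3) i by auto
  have ds: "concat ?ds = r i"
    and cut: "p \<noteq> [] \<Longrightarrow> strict_prefix p (r i) \<Longrightarrow> red (winv p) \<in> benois_V ?R \<Longrightarrow>
      \<exists>j\<in>{1..length ?ds}. p = concat (take j ?ds)" for p
    using is_benois_decomposition_benois_decomposition[of ?R "r i"]
    unfolding is_benois_decomposition_def by blast+
  have es: "concat ?es = r i" by (rule adjan_decomposition(2)[OF R])
  have "\<exists>j\<le>length ?ds. p = concat (take j ?ds)" if p: "p = concat (take k ?es)" for p k
  proof -
    have "prefix p (r i)" using concat_take_prefix[of k ?es] p es by simp
    then consider "p = []" | "p = r i" | "p \<noteq> []" "strict_prefix p (r i)"
      by (auto simp: strict_prefix_def)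
    then show ?thesis
    proof cases
      case 1
      then show ?thesis by (intro exI[of _ 0]) simp
    next
      case 2
      then show ?thesis using ds by (intro exI[of _ "length ?ds"]) simp
    next
      case 3
      have "red (winv p) \<in> benois_V ?R"
        using adjan_U_inverse_in_benois_V[OF R(1) adjan_partial_product_in_U[OF R]] p by simp
      then show ?thesis using cut[OF 3] by auto
    qed
  qed
  then show "refines ?ds ?es" using ds es by (auto simp: refines_def)
qed

end
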